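(* Let $1<p_1,p_2,q<\infty$, let $J=[c,d]$, $c<d$, and let $u,v_1,v_2$ be measurable weights on $J$ with $0<u,v_1,v_2<\infty$ a.e. on $J$, $u$ integrable on $J$, and $v_1,v_2$ essentially bounded below on $J$ by positive constants. Then, whenever the corresponding quantities are defined, $$\mathfrak B_1=A_1,$$ $$\mathfrak B_2=\left(\frac{r_2}{p_2'}\right)^{1/r_2}A_2,\qquad \mathfrak B_3=\left(\frac{r_1}{p_1'}\right)^{1/r_1}A_3,$$ $$\mathfrak B_4=\left(\frac{r_2}{p_2'}\right)^{1/r_2}A_4,\qquad \mathfrak B_5=\left(\frac{r_1}{p_1'}\right)^{1/r_1}A_5,$$ $$\mathfrak B_6=\left(\frac{r_2}{p_2'}\right)^{1/r_2}\left(\frac{\kappa}{p_1'}\right)^{1/\kappa}A_6,\qquad \mathfrak B_7=\left(\frac{r_1}{p_1'}\right)^{1/r_1}\left(\frac{\kappa}{p_2'}\right)^{1/\kappa}A_7.$$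
   Context: Notation: $s'=s/(s-1)$; $U(x)=\int_x^du(t)\,dt$; $V_i(x)=\int_c^xv_i(t)^{1-p_i'}dt$; $\Phi_i(x)=V_i(x)^{1/p_i'}$, $i=1,2$. When $q<p_i$: $\frac1{r_i}=\frac1q-\frac1{p_i}$ and $\mu_i=d(\Phi_i^{r_i})$. When $\frac1q>\frac1{p_1}+\frac1{p_2}$: $\frac1\kappa=\frac1q-\frac1{p_1}-\frac1{p_2}$. Here, for $G:[c,d]\to[0,\infty)$ nondecreasing and right-continuous, $dG$ is the Borel measure on $[c,d]$ with $dG([c,x])=G(x)$ for all $x$. Stieltjes-type quantities: - $\mathfrak B_1=\sup_{x\in J}U(x)^{1/q}\Phi_1(x)\Phi_2(x)$; - $\mathfrak B_2=\sup_{x\in J}\Phi_1(x)\left[\int_{(x,d]}U^{r_2/q}d\mu_2\right]^{1/r_2}$ and $\mathfrak B_3=\sup_{x\in J}\Phi_2(x)\left[\int_{(x,d]}U^{r_1/q}d\mu_1\right]^{1/r_1}$; - $\mathfrak B_4=\sup_{x\in J}\Phi_1(x)\left[\int_{[x,d]}U^{r_2/q}d\mu_2\right]^{1/r_2}$ and $\mathfrak B_5=\sup_{x\in J}\Phi_2(x)\left[\int_{(x,d]}U^{r_1/q}d\mu_1\right]^{1/r_1}$; - $\mathfrak B_6=\left[\int_J\left(\int_{[x,d]}U^{r_2/q}d\mu_2\right)^{\kappa/r_2}d(\Phi_1^\kappa)(x)\right]^{1/\kappa}$ and $\mathfrak B_7=\left[\int_J\left(\int_{(x,d]}U^{r_1/q}d\mu_1\right)^{\kappa/r_1}d(\Phi_2^\kappa)(x)\right]^{1/\kappa}$.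 Classical quantities: - $A_1=\sup_{c<x<d}U(x)^{1/q}V_1(x)^{1/p_1'}V_2(x)^{1/p_2'}$; - $A_2=\sup_{c<x<d}V_1(x)^{1/p_1'}\left[\int_x^dU(t)^{r_2/q}V_2(t)^{r_2/q'}v_2(t)^{1-p_2'}dt\right]^{1/r_2}$; - $A_3=\sup_{c<x<d}V_2(x)^{1/p_2'}\left[\int_x^dU(t)^{r_1/q}V_1(t)^{r_1/q'}v_1(t)^{1-p_1'}dt\right]^{1/r_1}$; - $A_4$ has the same formula as $A_2$, and $A_5$ the same formula as $A_3$; - $A_6=\left[\int_c^d\left(\int_x^dU(t)^{r_2/q}V_2(t)^{r_2/q'}v_2(t)^{1-p_2'}dt\right)^{\kappa/r_2}V_1(x)^{\kappa/r_2'}v_1(x)^{1-p_1'}dx\right]^{1/\kappa}$; - $A_7=\left[\int_c^d\left(\int_x^dU(t)^{r_1/q}V_1(t)^{r_1/q'}v_1(t)^{1-p_1'}dt\right)^{\kappa/r_1}V_2(x)^{\kappa/r_1'}v_2(x)^{1-p_2'}dx\right]^{1/\kappa}$. Parameter regions in which these are considered: index $1$ for $p_1,p_2\le q$ and also in the two mixed regions; index $2$ for $p_1\le q<p_2$; index $3$ for $p_2\le q<p_1$; indices $4,5$ for $q<\min\{p_1,p_2\}$ and $\frac1q\le\frac1{p_1}+\frac1{p_2}$; indices $6,7$ for $q<\min\{p_1,p_2\}$ and $\frac1q>\frac1{p_1}+\frac1{p_2}$. *)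

theory Defs
  imports "HOL-Analysis.Analysis"
begin

text \<open>
  Weights and all derived quantities take values in \<open>[0, \<infinity>]\<close> (type \<^typ>\<open>ennreal\<close>), so that
  every integral and supremum below exists without side conditions. Powers with a real exponent
  follow the usual conventions at the two endpoints: \<open>0\<close> to a negative power is \<open>\<infinity>\<close>,
  \<open>\<infinity>\<close> to a negative power is \<open>0\<close>, and the exponent \<open>0\<close> gives \<open>1\<close>.
\<close>

definition epowr :: "ennreal \<Rightarrow> real \<Rightarrow> ennreal"  (infixr "epowr" 80) where
  "x epowr a =
     (if a = 0 then 1
      else if x = 0 then (if a < 0 then \<infinity> else 0)
      else if x = \<infinity> then (if a < 0 then 0 else \<infinity>)
      else ennreal (enn2real x powr a))"

definition conj_exp :: "real \<Rightarrow> real" where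
  "conj_exp s = s / (s - 1)"

text \<open>
  The measure \<open>dG\<close> on \<open>[c,d]\<close>: \<open>G\<close> is extended by \<open>0\<close> to the left of \<open>c\<close> and by \<open>G(d)\<close> to the
  right of \<open>d\<close>, so a positive value \<open>G(c)\<close> becomes an atom at \<open>c\<close>. The lemma after the
  definition is the defining property \<open>dG([c,x]) = G(x)\<close>.
\<close>

definition stieltjes_measure :: "real \<Rightarrow> real \<Rightarrow> (real \<Rightarrow> real) \<Rightarrow> real measure" where
  "stieltjes_measure c d G =
     restrict_space (interval_measure (\<lambda>x. if x < c then 0 else G (min x d))) {c..d}"

lemma emeasure_stieltjes_measure:
  fixes G :: "real \<Rightarrow> real"
  assumes nonneg: "0 \<le> G c"
    and mono: "mono_on {c..d} G"
    and right_cont: "\<And>x. x \<in> {c..<d} \<Longrightarrow> continuous (at_right x) G"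
    and x: "x \<in> {c..d}"
  shows "emeasure (stieltjes_measure c d G) {c..x} = ennreal (G x)"
proof -
  define F where "F = (\<lambda>x. if x < c then 0 else G (min x d))"
  define M where "M = interval_measure F"
  have cd: "c \<le> d" using x by simp
  have F_mono: "F a \<le> F b" if "a \<le> b" for a b
  proof -
    have "0 \<le> G (min b d)" if "c \<le> b"
      using mono_onD[OF mono, of c "min b d"] nonneg cd that by auto
    moreover have "G (min a d) \<le> G (min b d)" if "c \<le> a"
      using mono_onD[OF mono, of "min a d" "min b d"] cd that \<open>a \<le> b\<close> by auto
    ultimately show ?thesis
      using that by (auto simp: F_def)
  qed
  have F_cont: "continuous (at_right a) F" for a
  proof -
    consider "a < c" | "a \<in> {c..<d}" | "d \<le> a" "c \<le> a" by fastforce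
    then show ?thesis
    proof cases
      case 1
      have "eventually (\<lambda>y. F y = 0) (at_right a)"
        using eventually_at_right[OF 1] 1 by (auto simp: F_def)
      then show ?thesis
        using 1 by (auto simp: continuous_within F_def intro: tendsto_eventually)
    next
      case 2
      have "eventually (\<lambda>y. F y = G y) (at_right a)"
        using 2 eventually_at_right[of a d] by (auto simp: F_def min_def)
      moreover have "F a = G a" using 2 by (auto simp: F_def min_def)
      ultimately show ?thesis
        using right_cont[OF 2] by (auto simp: continuous_within cong: filterlim_cong)
    next
      case 3
      have "eventually (\<lambda>y. F y = F a) (at_right a)"
        unfolding eventually_at_right_field
        using 3 by (intro exI[of _ "a + 1"]) (auto simp: F_def min_def)
      then show ?thesis
        by (auto simp: continuous_within intro: tendsto_eventually)
    qed
  qed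
  have Ioc: "emeasure M {a<..b} = ennreal (F b - F a)" if "a \<le> b" for a b
    unfolding M_def using emeasure_interval_measure_Ioc[of a b F] that F_mono F_cont by blast
  have null: "{c - 1<..<c} \<in> null_sets M"
  proof -
    have sub: "{c - 1<..<c} \<subseteq> (\<Union>n. {c - 1<..c - inverse (real (Suc n))})"
    proof
      fix y assume y: "y \<in> {c - 1<..<c}"
      then obtain n where "inverse (real (Suc n)) < c - y"
        using reals_Archimedean[of "c - y"] by auto
      then have "y \<le> c - inverse (real (Suc n))" by linarith
      with y have "y \<in> {c - 1<..c - inverse (real (Suc n))}"
        by (simp only: greaterThanLessThan_iff greaterThanAtMost_iff)
      then show "y \<in> (\<Union>n. {c - 1<..c - inverse (real (Suc n))})" by blast
    qed
    have "{c - 1<..c - inverse (real (Suc n))} \<in> null_sets M" for n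
    proof -
      have "inverse (real (Suc n)) \<le> 1" and pos: "0 < inverse (real (Suc n))"
        using inverse_le_1_iff[of "real (Suc n)"] by simp_all
      then have le: "c - 1 \<le> c - inverse (real (Suc n))" by linarith
      have "F (c - inverse (real (Suc n))) = 0" and "F (c - 1) = 0"
        unfolding F_def using pos by argo+
      with Ioc[OF le] have "emeasure M {c - 1<..c - inverse (real (Suc n))} = 0" by simp
      then show ?thesis by (intro null_setsI) (simp_all add: M_def)
    qed
    then have "(\<Union>n. {c - 1<..c - inverse (real (Suc n))}) \<in> null_sets M"
      by (rule null_sets_UN)
    moreover have "{c - 1<..<c} \<in> sets M" by (simp add: M_def)
    ultimately show ?thesis using sub by (rule null_sets_subset)
  qed
  have "emeasure (stieltjes_measure c d G) {c..x} = emeasure M {c..x}"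
    unfolding stieltjes_measure_def M_def F_def
    by (rule emeasure_restrict_space) (use x in simp_all)
  also have "\<dots> = emeasure M ({c..x} \<union> {c - 1<..<c})"
    using emeasure_Un_null_set[OF _ null, of "{c..x}"] by (simp add: M_def)
  also have "{c..x} \<union> {c - 1<..<c} = {c - 1<..x}"
    using x by auto
  also have "emeasure M {c - 1<..x} = ennreal (F x - F (c - 1))"
    using x by (intro Ioc) simp
  also have "F x - F (c - 1) = G x"
    using x by (simp add: F_def)
  finally show ?thesis .
qed

context
  fixes c d p\<^sub>1 p\<^sub>2 q :: real
    and u v\<^sub>1 v\<^sub>2 :: "real \<Rightarrow> ennreal"
begin

definition U :: "real \<Rightarrow> ennreal" where
  "U x = (\<integral>\<^sup>+t\<in>{x..d}. u t \<partial>lebesgue)"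

definition V\<^sub>1 :: "real \<Rightarrow> ennreal" where
  "V\<^sub>1 x = (\<integral>\<^sup>+t\<in>{c..x}. v\<^sub>1 t epowr (1 - conj_exp p\<^sub>1) \<partial>lebesgue)"

definition V\<^sub>2 :: "real \<Rightarrow> ennreal" where
  "V\<^sub>2 x = (\<integral>\<^sup>+t\<in>{c..x}. v\<^sub>2 t epowr (1 - conj_exp p\<^sub>2) \<partial>lebesgue)"

definition \<Phi>\<^sub>1 :: "real \<Rightarrow> ennreal" where
  "\<Phi>\<^sub>1 x = V\<^sub>1 x epowr (1 / conj_exp p\<^sub>1)"

definition \<Phi>\<^sub>2 :: "real \<Rightarrow> ennreal" where
  "\<Phi>\<^sub>2 x = V\<^sub>2 x epowr (1 / conj_exp p\<^sub>2)"

definition r\<^sub>1 :: real where "r\<^sub>1 = 1 / (1 / q - 1 / p\<^sub>1)"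

definition r\<^sub>2 :: real where "r\<^sub>2 = 1 / (1 / q - 1 / p\<^sub>2)"

definition \<kappa> :: real where "\<kappa> = 1 / (1 / q - 1 / p\<^sub>1 - 1 / p\<^sub>2)"

text \<open>
  The distribution functions passed to \<^const>\<open>stieltjes_measure\<close> are real-valued; \<open>\<Phi>\<^sub>1\<close> and \<open>\<Phi>\<^sub>2\<close>
  are finite on \<open>[c,d]\<close> when \<open>v\<^sub>1\<close> and \<open>v\<^sub>2\<close> are essentially bounded below by positive constants,
  so \<^const>\<open>enn2real\<close> loses nothing there.
\<close>

definition \<mu>\<^sub>1 :: "real measure" where
  "\<mu>\<^sub>1 = stieltjes_measure c d (\<lambda>x. enn2real (\<Phi>\<^sub>1 x epowr r\<^sub>1))"

definition \<mu>\<^sub>2 :: "real measure" where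
  "\<mu>\<^sub>2 = stieltjes_measure c d (\<lambda>x. enn2real (\<Phi>\<^sub>2 x epowr r\<^sub>2))"

definition \<BB>\<^sub>1 :: ennreal where
  "\<BB>\<^sub>1 = (SUP x\<in>{c..d}. U x epowr (1 / q) * \<Phi>\<^sub>1 x * \<Phi>\<^sub>2 x)"

definition \<BB>\<^sub>2 :: ennreal where
  "\<BB>\<^sub>2 = (SUP x\<in>{c..d}. \<Phi>\<^sub>1 x * (\<integral>\<^sup>+t\<in>{x<..d}. U t epowr (r\<^sub>2 / q) \<partial>\<mu>\<^sub>2) epowr (1 / r\<^sub>2))"

definition \<BB>\<^sub>3 :: ennreal where
  "\<BB>\<^sub>3 = (SUP x\<in>{c..d}. \<Phi>\<^sub>2 x * (\<integral>\<^sup>+t\<in>{x<..d}. U t epowr (r\<^sub>1 / q) \<partial>\<mu>\<^sub>1) epowr (1 / r\<^sub>1))"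

definition \<BB>\<^sub>4 :: ennreal where
  "\<BB>\<^sub>4 = (SUP x\<in>{c..d}. \<Phi>\<^sub>1 x * (\<integral>\<^sup>+t\<in>{x..d}. U t epowr (r\<^sub>2 / q) \<partial>\<mu>\<^sub>2) epowr (1 / r\<^sub>2))"

definition \<BB>\<^sub>5 :: ennreal where
  "\<BB>\<^sub>5 = (SUP x\<in>{c..d}. \<Phi>\<^sub>2 x * (\<integral>\<^sup>+t\<in>{x<..d}. U t epowr (r\<^sub>1 / q) \<partial>\<mu>\<^sub>1) epowr (1 / r\<^sub>1))"

definition \<BB>\<^sub>6 :: ennreal where
  "\<BB>\<^sub>6 = (\<integral>\<^sup>+x\<in>{c..d}. (\<integral>\<^sup>+t\<in>{x..d}. U t epowr (r\<^sub>2 / q) \<partial>\<mu>\<^sub>2) epowr (\<kappa> / r\<^sub>2)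
           \<partial>stieltjes_measure c d (\<lambda>x. enn2real (\<Phi>\<^sub>1 x epowr \<kappa>))) epowr (1 / \<kappa>)"

definition \<BB>\<^sub>7 :: ennreal where
  "\<BB>\<^sub>7 = (\<integral>\<^sup>+x\<in>{c..d}. (\<integral>\<^sup>+t\<in>{x<..d}. U t epowr (r\<^sub>1 / q) \<partial>\<mu>\<^sub>1) epowr (\<kappa> / r\<^sub>1)
           \<partial>stieltjes_measure c d (\<lambda>x. enn2real (\<Phi>\<^sub>2 x epowr \<kappa>))) epowr (1 / \<kappa>)"

definition A\<^sub>1 :: ennreal where
  "A\<^sub>1 = (SUP x\<in>{c<..<d}.
     U x epowr (1 / q) * V\<^sub>1 x epowr (1 / conj_exp p\<^sub>1) * V\<^sub>2 x epowr (1 / conj_exp p\<^sub>2))"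

definition A\<^sub>2 :: ennreal where
  "A\<^sub>2 = (SUP x\<in>{c<..<d}. V\<^sub>1 x epowr (1 / conj_exp p\<^sub>1) *
     (\<integral>\<^sup>+t\<in>{x..d}. U t epowr (r\<^sub>2 / q) * V\<^sub>2 t epowr (r\<^sub>2 / conj_exp q) *
        v\<^sub>2 t epowr (1 - conj_exp p\<^sub>2) \<partial>lebesgue) epowr (1 / r\<^sub>2))"

definition A\<^sub>3 :: ennreal where
  "A\<^sub>3 = (SUP x\<in>{c<..<d}. V\<^sub>2 x epowr (1 / conj_exp p\<^sub>2) *
     (\<integral>\<^sup>+t\<in>{x..d}. U t epowr (r\<^sub>1 / q) * V\<^sub>1 t epowr (r\<^sub>1 / conj_exp q) *
        v\<^sub>1 t epowr (1 - conj_exp p\<^sub>1) \<partial>lebesgue) epowr (1 / r\<^sub>1))"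

definition A\<^sub>4 :: ennreal where "A\<^sub>4 = A\<^sub>2"

definition A\<^sub>5 :: ennreal where "A\<^sub>5 = A\<^sub>3"

definition A\<^sub>6 :: ennreal where
  "A\<^sub>6 = (\<integral>\<^sup>+x\<in>{c..d}.
     (\<integral>\<^sup>+t\<in>{x..d}. U t epowr (r\<^sub>2 / q) * V\<^sub>2 t epowr (r\<^sub>2 / conj_exp q) *
        v\<^sub>2 t epowr (1 - conj_exp p\<^sub>2) \<partial>lebesgue) epowr (\<kappa> / r\<^sub>2) *
     V\<^sub>1 x epowr (\<kappa> / conj_exp r\<^sub>2) * v\<^sub>1 x epowr (1 - conj_exp p\<^sub>1) \<partial>lebesgue) epowr (1 / \<kappa>)"

definition A\<^sub>7 :: ennreal where
  "A\<^sub>7 = (\<integral>\<^sup>+x\<in>{c..d}.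
     (\<integral>\<^sup>+t\<in>{x..d}. U t epowr (r\<^sub>1 / q) * V\<^sub>1 t epowr (r\<^sub>1 / conj_exp q) *
        v\<^sub>1 t epowr (1 - conj_exp p\<^sub>1) \<partial>lebesgue) epowr (\<kappa> / r\<^sub>1) *
     V\<^sub>2 x epowr (\<kappa> / conj_exp r\<^sub>1) * v\<^sub>2 x epowr (1 - conj_exp p\<^sub>2) \<partial>lebesgue) epowr (1 / \<kappa>)"

end

end

theory Submission
  imports Defs
begin

text \<open>
  Put \<open>w = v powr (1 - p')\<close>, so that \<open>V(x) = \<integral>\<^sub>c\<^sup>x w\<close> and \<open>\<Phi> = V powr (1/p')\<close>. Every Stieltjes measure in the
  proposition has the form \<open>d(V powr \<alpha>)\<close> with \<open>\<alpha> > 1\<close>: \<open>\<alpha> = r/p'\<close> for \<open>\<mu> = d(\<Phi> powr r)\<close>, and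
  \<open>\<alpha> = \<kappa>/p'\<close> for \<open>d(\<Phi> powr \<kappa>)\<close>. The whole proposition rests on the chain rule
  \<open>d(V powr \<alpha>) = \<alpha> V powr (\<alpha>-1) w dx\<close>,
  which is \<open>nn_integral_power_measure\<close> below. It turns each Stieltjes integral into the corresponding
  weighted Lebesgue integral times \<open>\<alpha>\<close>. The exponents agree because \<open>1/r = 1/q - 1/p\<close> gives
  \<open>r/p' - 1 = r/q'\<close>; the same identity with \<open>(q, p, r)\<close> replaced by \<open>(r\<^sub>2, p\<^sub>1, \<kappa>)\<close> gives
  \<open>\<kappa>/p\<^sub>1' - 1 = \<kappa>/r\<^sub>2'\<close>, since \<open>1/\<kappa> = 1/r\<^sub>2 - 1/p\<^sub>1\<close>. The outer powers \<open>1/r\<close> and \<open>1/\<kappa>\<close> then produce the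
  stated constants.

  The lower bound on \<open>v\<close> makes \<open>w\<close> essentially bounded. Hence \<open>V\<close> is Lipschitz, and the chain rule needs no
  differentiation almost everywhere: on a short interval \<open>[a,b]\<close> both \<open>\<integral> \<alpha> V powr (\<alpha>-1) w\<close> and the
  increment of \<open>V powr \<alpha>\<close> lie between \<open>g(a) (V(b) - V(a))\<close> and \<open>g(b) (V(b) - V(a))\<close>, where
  \<open>g = \<alpha> V powr (\<alpha>-1)\<close> is continuous and nondecreasing. The difference of the two sides of the
  chain rule, integrated from \<open>c\<close> to \<open>x\<close>, therefore has derivative zero in \<open>x\<close> (\<open>power_integral_function\<close>).

  Two differences between the quantities compared are harmless. Since \<open>d(V powr \<alpha>)\<close> has no atoms,
  integrals over \<open>[x,d]\<close> and \<open>(x,d]\<close> coincide; and the suprema over \<open>[c,d]\<close> and \<open>(c,d)\<close> coincide, because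
  \<open>\<Phi>\<close> vanishes at \<open>c\<close> and \<open>U\<close>, like the tail integrals, vanishes at \<open>d\<close>.
\<close>

section \<open>Powers with values in the extended half-line\<close>

lemma epowr_ennreal: "0 \<le> x \<Longrightarrow> 0 < a \<Longrightarrow> ennreal x epowr a = ennreal (x powr a)"
  by (simp add: epowr_def)

lemma zero_epowr: "0 < a \<Longrightarrow> 0 epowr a = 0"
  by (simp add: epowr_def)

lemma top_epowr: "0 < a \<Longrightarrow> top epowr a = top"
  by (simp add: epowr_def)

lemma epowr_epowr:
  assumes "0 < a" "0 < b"
  shows "(x epowr a) epowr b = x epowr (a * b)"
  using assms by (cases x) (simp_all add: epowr_ennreal top_epowr powr_powr)

lemma ennreal_mult_epowr:
  assumes "0 < a" "0 < k"
  shows "(ennreal k * x) epowr a = ennreal (k powr a) * x epowr a"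
proof (cases x)
  case (real y)
  then show ?thesis
    using assms by (simp add: epowr_ennreal ennreal_mult[symmetric] powr_mult)
next
  case top
  then show ?thesis using assms by (simp add: top_epowr ennreal_mult_top)
qed

lemma borel_measurable_epowr [measurable (raw)]:
  assumes f: "f \<in> borel_measurable M"
  shows "(\<lambda>x. f x epowr a) \<in> borel_measurable M"
proof (rule measurable_compose[OF f])
  show "(\<lambda>x. x epowr a) \<in> borel_measurable borel"
    unfolding epowr_def by measurable
qed

lemma epowr_neg_le:
  assumes "0 < b" "ennreal b \<le> x" "a < 0"
  shows "x epowr a \<le> ennreal (b powr a)"
proof (cases x)
  case (real y)
  then have "b \<le> y" using assms by (simp add: ennreal_le_iff)
  then have "y powr a \<le> b powr a" using assms by (intro powr_mono2') auto
  then show ?thesis using real assms \<open>b \<le> y\<close> by (simp add: epowr_def ennreal_leI)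
qed (use assms in \<open>simp add: epowr_def\<close>)

lemma borel_measurable_monotone_ennreal:
  fixes f :: "real \<Rightarrow> ennreal"
  assumes "mono f \<or> antimono f"
  shows "f \<in> borel_measurable borel"
proof (rule borel_measurableI_le)
  fix y
  have "is_interval {x. f x \<le> y}"
    unfolding is_interval_1 using assms
    by (metis (mono_tags) mem_Collect_eq monoD antimonoD order_trans)
  then show "{x \<in> space borel. f x \<le> y} \<in> sets borel"
    by (simp add: real_interval_borel_measurable)
qed

section \<open>The chain rule for powers of an indefinite integral\<close>

text \<open>
  The difference \<open>F\<close> of the two sides has derivative zero. Its increment over \<open>[a,b]\<close> is at most
  \<open>(W b - W a) (g b - g a)\<close>; the first factor is \<open>O(b - a)\<close> because \<open>w\<close> is bounded and the second tends
  to zero because \<open>g\<close> is continuous. The hypothesis \<open>1 < \<alpha>\<close> makes \<open>g\<close> nondecreasing and continuous up to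
  the point where \<open>W\<close> vanishes.
\<close>

lemma power_integral_function:
  fixes w :: "real \<Rightarrow> real"
  assumes meas: "w \<in> borel_measurable lebesgue"
    and bounds: "\<And>t. 0 \<le> w t" "\<And>t. w t \<le> B"
    and \<alpha>: "1 < \<alpha>" and "c \<le> x"
  defines "W \<equiv> \<lambda>x. integral {c..x} w"
  shows "((\<lambda>t. \<alpha> * W t powr (\<alpha> - 1) * w t) has_integral W x powr \<alpha>) {c..x}"
proof -
  have B: "0 \<le> B" using bounds[of 0] by linarith
  have int: "w integrable_on {a..b}" for a b
  proof (rule measurable_bounded_by_integrable_imp_integrable)
    show "w \<in> borel_measurable (lebesgue_on {a..b})"
      using meas by (rule measurable_restrict_space1)
    show "(\<lambda>_. B) integrable_on {a..b}" by (rule integrable_const_ivl)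
  qed (use bounds in auto)
  have W_add: "W b = W a + integral {a..b} w" if "c \<le> a" "a \<le> b" for a b
    unfolding W_def using Henstock_Kurzweil_Integration.integral_combine[OF that int] by simp
  have W_step: "0 \<le> W b - W a" "W b - W a \<le> B * (b - a)" if "c \<le> a" "a \<le> b" for a b
  proof -
    show "0 \<le> W b - W a"
      using W_add[OF that] Henstock_Kurzweil_Integration.integral_nonneg[OF int] bounds by auto
    have "integral {a..b} w \<le> integral {a..b} (\<lambda>_. B)"
      by (rule integral_le) (use int bounds in auto)
    then show "W b - W a \<le> B * (b - a)" using W_add[OF that] that by (simp add: mult.commute)
  qed
  have W_nonneg: "0 \<le> W a" if "c \<le> a" for a
    using W_step(1)[of c a] that by (simp add: W_def)
  have W_cont: "continuous_on {c..x} W"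
    unfolding W_def by (rule indefinite_integral_continuous_1[OF int])
  define g where "g y = \<alpha> * W y powr (\<alpha> - 1)" for y
  have g_nonneg: "0 \<le> g y" for y using \<alpha> by (simp add: g_def)
  have g_mono: "g a \<le> g b" if "c \<le> a" "a \<le> b" for a b
    unfolding g_def using W_step(1)[OF that] W_nonneg[OF that(1)] \<alpha>
    by (intro mult_left_mono powr_mono2) auto
  have g_cont: "continuous_on {c..x} g"
    unfolding g_def
    by (intro continuous_intros continuous_on_powr' W_cont) (use \<alpha> W_nonneg in auto)
  have gw_int: "(\<lambda>t. g t * w t) integrable_on {a..b}" if "c \<le> a" "b \<le> x" for a b
  proof (rule measurable_bounded_by_integrable_imp_integrable)
    have "continuous_on {a..b} g" by (rule continuous_on_subset[OF g_cont]) (use that in auto)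
    then have "g \<in> borel_measurable (lebesgue_on {a..b})"
      by (intro continuous_imp_measurable_on_sets_lebesgue) auto
    then show "(\<lambda>t. g t * w t) \<in> borel_measurable (lebesgue_on {a..b})"
      using measurable_restrict_space1[OF meas] by (rule borel_measurable_times)
    show "(\<lambda>_. g x * B) integrable_on {a..b}" by (rule integrable_const_ivl)
    show "norm (g t * w t) \<le> g x * B" if "t \<in> {a..b}" for t
      using that \<open>c \<le> a\<close> \<open>b \<le> x\<close> g_nonneg bounds g_mono[of t x] B
      by (auto simp: abs_mult intro!: mult_mono)
  qed auto
  define F where "F y = integral {c..y} (\<lambda>t. g t * w t) - W y powr \<alpha>" for y
  have F_step: "\<bar>F b - F a\<bar> \<le> B * (b - a) * (g b - g a)" if "c \<le> a" "a \<le> b" "b \<le> x" for a b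
  proof -
    define I where "I = integral {a..b} (\<lambda>t. g t * w t)"
    have comb: "integral {c..b} (\<lambda>t. g t * w t) = integral {c..a} (\<lambda>t. g t * w t) + I"
      unfolding I_def
      using Henstock_Kurzweil_Integration.integral_combine[OF that(1,2) gw_int] that by simp
    have wab: "integral {a..b} w = W b - W a" using W_add[of a b] that by simp
    have "integral {a..b} (\<lambda>t. g a * w t) \<le> I"
      unfolding I_def
      by (rule integral_le)
        (use that int gw_int bounds g_mono in \<open>auto intro!: integrable_on_mult_right mult_right_mono\<close>)
    then have I_lo: "g a * (W b - W a) \<le> I" by (simp add: wab)
    have "I \<le> integral {a..b} (\<lambda>t. g b * w t)"
      unfolding I_def
      by (rule integral_le)
        (use that int gw_int bounds g_mono in \<open>auto intro!: integrable_on_mult_right mult_right_mono\<close>)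
    then have I_hi: "I \<le> g b * (W b - W a)" by (simp add: wab)
    \<comment> \<open>The mean value theorem in the variable \<open>W\<close>: only interior points, where \<open>W\<close> is positive, occur.\<close>
    have "g a * (W b - W a) \<le> W b powr \<alpha> - W a powr \<alpha> \<and>
        W b powr \<alpha> - W a powr \<alpha> \<le> g b * (W b - W a)"
    proof (cases "W a = W b")
      case False
      with W_step(1)[of a b] that have lt: "W a < W b" by simp
      have "\<exists>z>W a. z < W b \<and>
          W b powr \<alpha> - W a powr \<alpha> = (W b - W a) * (\<alpha> * z powr (\<alpha> - 1))"
      proof -
        have der: "((\<lambda>y. y powr \<alpha>) has_real_derivative \<alpha> * z powr (\<alpha> - 1)) (at z)"
          if "W a < z" for z
          using that W_nonneg[OF \<open>c \<le> a\<close>] by (intro has_real_derivative_powr) auto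
        have "continuous_on {W a..W b} (\<lambda>y. y powr \<alpha>)"
          by (intro continuous_on_powr' continuous_intros) (use \<alpha> W_nonneg[OF \<open>c \<le> a\<close>] in auto)
        from MVT[OF lt this] der obtain l z where
          z: "W a < z" "z < W b" "((\<lambda>y. y powr \<alpha>) has_real_derivative l) (at z)"
            "W b powr \<alpha> - W a powr \<alpha> = (W b - W a) * l"
          using real_differentiable_def by blast
        have "l = \<alpha> * z powr (\<alpha> - 1)" using DERIV_unique[OF z(3) der[OF z(1)]] .
        with z show ?thesis by blast
      qed
      then obtain z where z: "W a < z" "z < W b"
        "W b powr \<alpha> - W a powr \<alpha> = (W b - W a) * (\<alpha> * z powr (\<alpha> - 1))" by blast
      have "W a powr (\<alpha> - 1) \<le> z powr (\<alpha> - 1)" "z powr (\<alpha> - 1) \<le> W b powr (\<alpha> - 1)"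
        using z W_nonneg[OF \<open>c \<le> a\<close>] \<alpha> by (auto intro!: powr_mono2)
      then have "g a \<le> \<alpha> * z powr (\<alpha> - 1)" "\<alpha> * z powr (\<alpha> - 1) \<le> g b"
        unfolding g_def using \<alpha> by auto
      then show ?thesis
        unfolding z(3) using lt by (simp add: mult.commute mult_right_mono)
    qed simp
    with I_lo I_hi have "\<bar>I - (W b powr \<alpha> - W a powr \<alpha>)\<bar> \<le> (W b - W a) * (g b - g a)"
      by (simp add: algebra_simps) linarith
    also have "\<dots> \<le> B * (b - a) * (g b - g a)"
      using W_step[of a b] g_mono[of a b] that by (intro mult_right_mono) auto
    finally show ?thesis unfolding F_def comb by (simp add: algebra_simps)
  qed
  have F_sym: "\<bar>F y - F z\<bar> \<le> B * \<bar>y - z\<bar> * \<bar>g y - g z\<bar>" if "y \<in> {c..x}" "z \<in> {c..x}" for y z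
    using F_step[of y z] F_step[of z y] that g_mono[of y z] g_mono[of z y]
    by (cases "y \<le> z") (auto simp: abs_minus_commute)
  have "(F has_field_derivative 0) (at z within {c..x})" if z: "z \<in> {c..x}" for z
    unfolding has_field_derivative_iff
  proof (rule Lim_null_comparison)
    show "((\<lambda>y. B * \<bar>g y - g z\<bar>) \<longlongrightarrow> 0) (at z within {c..x})"
      using g_cont z by (auto simp: continuous_on_def intro!: tendsto_eq_intros)
    have "norm ((F y - F z) / (y - z)) \<le> B * \<bar>g y - g z\<bar>" if "y \<in> {c..x}" "y \<noteq> z" for y
      using F_sym[OF that(1) z] that by (simp add: abs_divide divide_le_eq mult_ac)
    then show "\<forall>\<^sub>F y in at z within {c..x}. norm ((F y - F z) / (y - z)) \<le> B * \<bar>g y - g z\<bar>"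
      by (auto simp: eventually_at_filter)
  qed
  then obtain k where "\<And>y. y \<in> {c..x} \<Longrightarrow> F y = k"
    using has_field_derivative_zero_constant[of "{c..x}" F] by (meson convex_closed_interval)
  then have "F x = F c" using \<open>c \<le> x\<close> by simp
  also have "F c = 0" by (simp add: F_def W_def)
  finally have "integral {c..x} (\<lambda>t. g t * w t) = W x powr \<alpha>" by (simp add: F_def)
  then show ?thesis
    using gw_int[of c x] unfolding g_def by (simp add: has_integral_iff)
qed

lemma nn_integral_lebesgue_has_integral:
  fixes f :: "real \<Rightarrow> real"
  assumes nonneg: "\<And>x. x \<in> S \<Longrightarrow> 0 \<le> f x" and I: "(f has_integral I) S"
  shows "(\<integral>\<^sup>+x\<in>S. ennreal (f x) \<partial>lebesgue) = ennreal I"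
  using nn_integral_has_integral_lebesgue'[OF nonneg I] by (simp add: nn_integral_completion)

lemma AE_lebesgue_on_iff:
  "S \<in> sets lebesgue \<Longrightarrow> (AE x in lebesgue_on S. P x) \<longleftrightarrow> (AE x in lebesgue. x \<in> S \<longrightarrow> P x)"
  by (rule AE_restrict_space_iff) simp

section \<open>The Stieltjes measure of a power of the mass\<close>

text \<open>
  In the application \<open>w = v powr (1 - p')\<close>, which is bounded because \<open>1 - p' < 0\<close> and \<open>v\<close> is bounded away
  from zero; \<open>mass\<close> is then \<open>V\<close>.
\<close>

locale bounded_density =
  fixes c d :: real and w :: "real \<Rightarrow> ennreal" and B :: real
  assumes c_less_d: "c < d"
    and measurable_density: "w \<in> borel_measurable (lebesgue_on {c..d})"
    and density_le: "AE t in lebesgue_on {c..d}. w t \<le> ennreal B"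
    and bound_nonneg: "0 \<le> B"
begin

definition mass :: "real \<Rightarrow> ennreal" where
  "mass x = (\<integral>\<^sup>+t\<in>{c..x}. w t \<partial>lebesgue)"

text \<open>
  A representative of the density that obeys the bound at every point, so that the real-valued chain rule
  applies to it; truncation changes the density on a null set only.
\<close>

definition truncated_density :: "real \<Rightarrow> real" where
  "truncated_density t = enn2real (min (w t * indicator {c..d} t) (ennreal B))"

definition real_mass :: "real \<Rightarrow> real" where
  "real_mass x = integral {c..x} truncated_density"

lemma borel_measurable_restricted_density: "(\<lambda>t. w t * indicator {c..d} t) \<in> borel_measurable lebesgue"
  using measurable_density by (subst (asm) borel_measurable_restrict_space_iff_ennreal) auto

lemma measurable_truncated_density: "truncated_density \<in> borel_measurable lebesgue"
  unfolding truncated_density_def using borel_measurable_restricted_density by measurable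

lemma truncated_density_bounds: "0 \<le> truncated_density t" "truncated_density t \<le> B"
proof -
  have "truncated_density t \<le> enn2real (ennreal B)"
    unfolding truncated_density_def by (rule enn2real_mono) (auto simp: less_top)
  then show "truncated_density t \<le> B" using bound_nonneg by simp
qed (simp add: truncated_density_def)

lemma AE_truncated_density: "AE t in lebesgue. t \<in> {c..d} \<longrightarrow> w t = ennreal (truncated_density t)"
proof -
  have "AE t in lebesgue. t \<in> {c..d} \<longrightarrow> w t \<le> ennreal B"
    using density_le by (simp add: AE_lebesgue_on_iff)
  then show ?thesis
  proof eventually_elim
    case (elim t)
    have "w t < top" if "t \<in> {c..d}" using elim that by (auto simp: less_top intro: le_less_trans)
    with elim show ?case by (auto simp: truncated_density_def min_def ennreal_enn2real)
  qed
qed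

lemma power_mass_integral_real:
  assumes "1 < \<alpha>" "c \<le> x"
  shows "((\<lambda>t. \<alpha> * real_mass t powr (\<alpha> - 1) * truncated_density t) has_integral real_mass x powr \<alpha>) {c..x}"
  unfolding real_mass_def
  by (rule power_integral_function[OF measurable_truncated_density truncated_density_bounds]) (use assms in auto)

lemma real_mass_has_integral: "(truncated_density has_integral real_mass x) {c..x}"
  unfolding real_mass_def has_integral_integral[symmetric]
proof (rule measurable_bounded_by_integrable_imp_integrable)
  show "truncated_density \<in> borel_measurable (lebesgue_on {c..x})"
    using measurable_truncated_density by (rule measurable_restrict_space1)
  show "(\<lambda>_. B) integrable_on {c..x}" by (rule integrable_const_ivl)
qed (use truncated_density_bounds in auto)

lemma real_mass_nonneg: "0 \<le> real_mass x"
  by (rule has_integral_nonneg[OF real_mass_has_integral]) (rule truncated_density_bounds)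

lemma mass_eq:
  assumes "x \<in> {c..d}"
  shows "mass x = ennreal (real_mass x)"
proof -
  have "mass x = (\<integral>\<^sup>+t\<in>{c..x}. ennreal (truncated_density t) \<partial>lebesgue)"
    unfolding mass_def using AE_truncated_density
    by (intro nn_integral_cong_AE) (use assms in \<open>auto elim!: eventually_mono split: split_indicator\<close>)
  also have "\<dots> = ennreal (real_mass x)"
    by (rule nn_integral_lebesgue_has_integral[OF _ real_mass_has_integral]) (rule truncated_density_bounds)
  finally show ?thesis .
qed

lemma mass_left: "mass c = 0"
  using c_less_d by (simp add: mass_eq real_mass_def)

lemma real_mass_mono: "c \<le> x \<Longrightarrow> x \<le> y \<Longrightarrow> real_mass x \<le> real_mass y"
  by (rule has_integral_subset_le[OF _ real_mass_has_integral real_mass_has_integral])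
    (auto simp: truncated_density_bounds)

lemma real_mass_continuous: "continuous_on {c..d} real_mass"
  unfolding real_mass_def
  using real_mass_has_integral by (intro indefinite_integral_continuous_1) (rule has_integral_integrable)

lemma power_mass_integral:
  assumes \<alpha>: "1 < \<alpha>" and x: "x \<in> {c..d}"
  shows "(\<integral>\<^sup>+t\<in>{c..x}. ennreal \<alpha> * mass t epowr (\<alpha> - 1) * w t \<partial>lebesgue) = mass x epowr \<alpha>"
proof -
  have "(\<integral>\<^sup>+t\<in>{c..x}. ennreal \<alpha> * mass t epowr (\<alpha> - 1) * w t \<partial>lebesgue) =
      (\<integral>\<^sup>+t\<in>{c..x}. ennreal (\<alpha> * real_mass t powr (\<alpha> - 1) * truncated_density t) \<partial>lebesgue)"
    using AE_truncated_density
  proof (intro nn_integral_cong_AE, eventually_elim)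
    case (elim t)
    show ?case
    proof (cases "t \<in> {c..x}")
      case True
      with x have t: "t \<in> {c..d}" by auto
      with elim have "w t = ennreal (truncated_density t)" by simp
      with \<alpha> show ?thesis
        by (simp add: mass_eq[OF t] epowr_ennreal real_mass_nonneg truncated_density_bounds ennreal_mult)
    qed simp
  qed
  also have "\<dots> = ennreal (real_mass x powr \<alpha>)"
    by (rule nn_integral_lebesgue_has_integral[OF _ power_mass_integral_real])
      (use assms truncated_density_bounds in auto)
  also have "\<dots> = mass x epowr \<alpha>"
    using \<alpha> by (simp add: mass_eq[OF x] epowr_ennreal real_mass_nonneg)
  finally show ?thesis .
qed

abbreviation power_measure :: "real \<Rightarrow> real measure" where
  "power_measure \<alpha> \<equiv> stieltjes_measure c d (\<lambda>x. enn2real (mass x epowr \<alpha>))"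

lemma emeasure_power_measure:
  assumes \<alpha>: "1 < \<alpha>" and x: "x \<in> {c..d}"
  shows "emeasure (power_measure \<alpha>) {c..x} = mass x epowr \<alpha>"
proof -
  define G where "G = (\<lambda>x. enn2real (mass x epowr \<alpha>))"
  have G: "G x = real_mass x powr \<alpha>" if "x \<in> {c..d}" for x
    using \<alpha> that by (simp add: G_def mass_eq epowr_ennreal real_mass_nonneg)
  have "emeasure (stieltjes_measure c d G) {c..x} = ennreal (G x)"
  proof (rule emeasure_stieltjes_measure)
    show "mono_on {c..d} G"
      using \<alpha> by (intro mono_onI) (simp add: G real_mass_nonneg powr_mono2 real_mass_mono)
    have "continuous_on {c..d} (\<lambda>x. real_mass x powr \<alpha>)"
      by (intro continuous_on_powr' real_mass_continuous continuous_intros) (use \<alpha> real_mass_nonneg in auto)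
    then have "continuous_on {c..d} G"
      by (rule continuous_on_eq) (simp add: G)
    show "continuous (at_right x) G" if "x \<in> {c..<d}" for x
    proof -
      have "continuous_on {x..d} G"
        by (rule continuous_on_subset[OF \<open>continuous_on {c..d} G\<close>]) (use that in auto)
      then have "continuous (at x within {x..d}) G"
        using that by (simp add: continuous_on_eq_continuous_within)
      then show ?thesis using that by (simp add: at_within_Icc_at_right)
    qed
  qed (use x in \<open>auto simp: G_def\<close>)
  then show ?thesis
    using \<alpha> by (simp add: G_def mass_eq[OF x] epowr_ennreal real_mass_nonneg)
qed

end

text \<open>
  Measures of intervals \<open>[c,x]\<close> are what is known about a Stieltjes measure; on finite measures carried by
  \<open>[c,d]\<close> they determine the half-lines \<open>(x,\<infinity>)\<close> by subtraction, and so the measure.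
\<close>

lemma measure_eqI_initial_segments:
  fixes M N :: "real measure"
  assumes sets: "sets M = sets borel" "sets N = sets borel"
    and cd: "c \<le> d"
    and outside: "emeasure M (- {c..d}) = 0" "emeasure N (- {c..d}) = 0"
    and finite: "emeasure M {c..d} < \<infinity>"
    and eq: "\<And>x. x \<in> {c..d} \<Longrightarrow> emeasure M {c..x} = emeasure N {c..x}"
  shows "M = N"
proof (rule measure_eqI_lessThan[OF sets])
  have tail: "emeasure X {x<..} =
      (if x < c then emeasure X {c..d} else if x < d then emeasure X {c..d} - emeasure X {c..x} else 0)"
    if X: "sets X = sets borel" and null: "emeasure X (- {c..d}) = 0" and fin: "emeasure X {c..d} < \<infinity>"
    for X :: "real measure" and x
  proof -
    have "- {c..d} \<in> null_sets X" using null X by (auto simp: null_sets_def)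
    then have "{x<..} - {c..d} \<in> null_sets X"
      by (rule null_sets_subset) (auto simp: X)
    then have "emeasure X ({x<..} \<inter> {c..d}) = emeasure X (({x<..} \<inter> {c..d}) \<union> ({x<..} - {c..d}))"
      by (subst emeasure_Un_null_set) (auto simp: X)
    also have "({x<..} \<inter> {c..d}) \<union> ({x<..} - {c..d}) = {x<..}" by auto
    finally have restr: "emeasure X {x<..} = emeasure X ({x<..} \<inter> {c..d})" by simp
    consider "x < c" | "c \<le> x" "x < d" | "d \<le> x" "c \<le> x" using cd by linarith
    then show ?thesis
    proof cases
      case 1
      then have "{x<..} \<inter> {c..d} = {c..d}" by auto
      then show ?thesis using 1 by (simp add: restr)
    next
      case 2
      then have "{x<..} \<inter> {c..d} = {c..d} - {c..x}" by auto
      moreover have "emeasure X {c..x} \<noteq> \<infinity>"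
        using emeasure_mono[of "{c..x}" "{c..d}" X] 2 fin X by (auto simp: less_top top_unique)
      ultimately show ?thesis using 2 by (simp add: restr emeasure_Diff X)
    next
      case 3
      then have "{x<..} \<inter> {c..d} = {}" by auto
      then show ?thesis using 3 by (simp add: restr)
    qed
  qed
  have finN: "emeasure N {c..d} < \<infinity>" using finite eq[of d] cd by simp
  fix x
  show "emeasure M {x<..} = emeasure N {x<..}"
    using tail[OF sets(1) outside(1) finite] tail[OF sets(2) outside(2) finN] eq[of x] eq[of d] cd by simp
  have "emeasure M {x<..} \<le> emeasure M {c..d}"
    using tail[OF sets(1) outside(1) finite, of x] by (simp add: diff_le_self_ennreal)
  then show "emeasure M {x<..} < \<infinity>"
    using finite by (rule le_less_trans)
qed

context bounded_density begin

lemma mono_mass: "mono mass"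
  unfolding mass_def mono_def
  by (auto intro!: nn_integral_mono mult_left_mono split: split_indicator)

lemma borel_measurable_mass: "mass \<in> borel_measurable borel"
  using mono_mass by (intro borel_measurable_monotone_ennreal) simp

text \<open>
  The chain rule as an identity of measures. The density is only Lebesgue measurable while the Stieltjes
  measure lives on Borel sets, so both are first pushed to the Borel sets of the line; there they agree on
  every \<open>[c,x]\<close> by \<open>emeasure_power_measure\<close> and \<open>power_mass_integral\<close>.
\<close>

lemma nn_integral_power_measure:
  assumes \<alpha>: "1 < \<alpha>" and f: "f \<in> borel_measurable borel"
  shows "(\<integral>\<^sup>+t. f t \<partial>power_measure \<alpha>) =
    ennreal \<alpha> * (\<integral>\<^sup>+t\<in>{c..d}. f t * mass t epowr (\<alpha> - 1) * w t \<partial>lebesgue)"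
proof -
  define P where "P = power_measure \<alpha>"
  define h where "h = (\<lambda>t. ennreal \<alpha> * mass t epowr (\<alpha> - 1) * (w t * indicator {c..d} t))"
  have mass_leb [measurable]: "mass \<in> borel_measurable lebesgue"
    and f_leb [measurable]: "f \<in> borel_measurable lebesgue"
    using borel_measurable_mass f by (auto intro: measurable_completion)
  note [measurable] = borel_measurable_restricted_density
  have h: "h \<in> borel_measurable lebesgue"
    unfolding h_def by measurable
  have sets_P: "sets P = sets (restrict_space borel {c..d})"
    unfolding P_def stieltjes_measure_def by (rule sets_restrict_space_cong) simp
  have id_P: "(\<lambda>t. t) \<in> measurable P borel"
    by (subst measurable_cong_sets[OF sets_P refl]) (simp add: measurable_restrict_space1)
  have id_h: "(\<lambda>t. t) \<in> measurable (density lebesgue h) borel"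
    using measurable_completion[of "\<lambda>t. t" lborel borel] by simp
  have space_P: "space P = {c..d}"
    unfolding P_def stieltjes_measure_def by (simp add: space_restrict_space)
  have "distr P borel (\<lambda>t. t) = distr (density lebesgue h) borel (\<lambda>t. t)"
  proof (rule measure_eqI_initial_segments[of _ _ c d])
    show eq: "emeasure (distr P borel (\<lambda>t. t)) {c..x} =
        emeasure (distr (density lebesgue h) borel (\<lambda>t. t)) {c..x}" if x: "x \<in> {c..d}" for x
    proof -
      have "emeasure (distr P borel (\<lambda>t. t)) {c..x} = emeasure P {c..x}"
        using x by (simp add: emeasure_distr[OF id_P] space_P Int_absorb2)
      also have "\<dots> = (\<integral>\<^sup>+t\<in>{c..x}. ennreal \<alpha> * mass t epowr (\<alpha> - 1) * w t \<partial>lebesgue)"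
        unfolding P_def using emeasure_power_measure[OF \<alpha> x] power_mass_integral[OF \<alpha> x] by simp
      also have "\<dots> = emeasure (distr (density lebesgue h) borel (\<lambda>t. t)) {c..x}"
        using x by (simp add: emeasure_distr[OF id_h] emeasure_density[OF h])
          (auto simp: h_def intro!: nn_integral_cong split: split_indicator)
      finally show ?thesis .
    qed
    show "emeasure (distr P borel (\<lambda>t. t)) (- {c..d}) = 0"
      by (simp add: emeasure_distr[OF id_P] space_P)
    show "emeasure (distr (density lebesgue h) borel (\<lambda>t. t)) (- {c..d}) = 0"
    proof -
      have "(\<lambda>t. h t * indicator (- {c..d}) t) = (\<lambda>t. 0)"
        by (auto simp: h_def split: split_indicator)
      then show ?thesis by (simp add: emeasure_distr[OF id_h] emeasure_density[OF h])
    qed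
    have "emeasure (distr P borel (\<lambda>t. t)) {c..d} = emeasure P {c..d}"
      by (simp add: emeasure_distr[OF id_P] space_P)
    also have "\<dots> = mass d epowr \<alpha>"
      unfolding P_def using c_less_d by (intro emeasure_power_measure \<alpha>) auto
    also have "\<dots> < \<infinity>"
      using c_less_d \<alpha> by (simp add: mass_eq epowr_ennreal real_mass_nonneg)
    finally show "emeasure (distr P borel (\<lambda>t. t)) {c..d} < \<infinity>" .
  qed (use c_less_d in auto)
  then have "(\<integral>\<^sup>+t. f t \<partial>P) = (\<integral>\<^sup>+t. f t \<partial>density lebesgue h)"
    using nn_integral_distr[OF id_P, of f] nn_integral_distr[OF id_h, of f] f by simp
  also have "\<dots> = (\<integral>\<^sup>+t. h t * f t \<partial>lebesgue)"
    by (rule nn_integral_density[OF h f_leb])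
  also have "\<dots> = (\<integral>\<^sup>+t. ennreal \<alpha> * (f t * mass t epowr (\<alpha> - 1) * (w t * indicator {c..d} t)) \<partial>lebesgue)"
    by (simp add: h_def mult_ac)
  also have "\<dots> = ennreal \<alpha> * (\<integral>\<^sup>+t. f t * mass t epowr (\<alpha> - 1) * (w t * indicator {c..d} t) \<partial>lebesgue)"
    by (intro nn_integral_cmult) measurable
  finally show ?thesis by (simp add: P_def mult_ac)
qed

lemma nn_integral_power_measure_on:
  assumes \<alpha>: "1 < \<alpha>" and f: "f \<in> borel_measurable borel"
    and S: "S \<subseteq> {c..d}" "S \<in> sets borel"
  shows "(\<integral>\<^sup>+t\<in>S. f t \<partial>power_measure \<alpha>) =
    ennreal \<alpha> * (\<integral>\<^sup>+t\<in>S. f t * mass t epowr (\<alpha> - 1) * w t \<partial>lebesgue)"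
proof -
  have "(\<lambda>t. f t * indicator S t) \<in> borel_measurable borel" using f S by measurable
  then have "(\<integral>\<^sup>+t\<in>S. f t \<partial>power_measure \<alpha>) = ennreal \<alpha> *
      (\<integral>\<^sup>+t\<in>{c..d}. (f t * indicator S t) * mass t epowr (\<alpha> - 1) * w t \<partial>lebesgue)"
    by (rule nn_integral_power_measure[OF \<alpha>])
  also have "(\<integral>\<^sup>+t\<in>{c..d}. (f t * indicator S t) * mass t epowr (\<alpha> - 1) * w t \<partial>lebesgue) =
      (\<integral>\<^sup>+t\<in>S. f t * mass t epowr (\<alpha> - 1) * w t \<partial>lebesgue)"
    using S by (intro nn_integral_cong) (auto split: split_indicator)
  finally show ?thesis .
qed

text \<open>
  Both kinds of tail give the same value, because the density form shows that there is no atom at \<open>x\<close>.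
\<close>

lemma tail_integral_power_measure:
  assumes \<alpha>: "1 < \<alpha>" and f: "f \<in> borel_measurable borel" and x: "x \<in> {c..d}"
  shows "(\<integral>\<^sup>+t\<in>{x..d}. f t \<partial>power_measure \<alpha>) =
      ennreal \<alpha> * (\<integral>\<^sup>+t\<in>{x..d}. f t * mass t epowr (\<alpha> - 1) * w t \<partial>lebesgue)"
    and "(\<integral>\<^sup>+t\<in>{x<..d}. f t \<partial>power_measure \<alpha>) =
      ennreal \<alpha> * (\<integral>\<^sup>+t\<in>{x..d}. f t * mass t epowr (\<alpha> - 1) * w t \<partial>lebesgue)"
proof -
  show "(\<integral>\<^sup>+t\<in>{x..d}. f t \<partial>power_measure \<alpha>) =
      ennreal \<alpha> * (\<integral>\<^sup>+t\<in>{x..d}. f t * mass t epowr (\<alpha> - 1) * w t \<partial>lebesgue)"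
    using x by (intro nn_integral_power_measure_on[OF \<alpha> f]) auto
  have "AE t in lebesgue. t \<noteq> x"
    using AE_lborel_singleton[of x] by (rule AE_completion)
  then have "(\<integral>\<^sup>+t\<in>{x<..d}. f t * mass t epowr (\<alpha> - 1) * w t \<partial>lebesgue) =
      (\<integral>\<^sup>+t\<in>{x..d}. f t * mass t epowr (\<alpha> - 1) * w t \<partial>lebesgue)"
    by (intro nn_integral_cong_AE) (auto elim!: eventually_mono split: split_indicator)
  moreover have "(\<integral>\<^sup>+t\<in>{x<..d}. f t \<partial>power_measure \<alpha>) =
      ennreal \<alpha> * (\<integral>\<^sup>+t\<in>{x<..d}. f t * mass t epowr (\<alpha> - 1) * w t \<partial>lebesgue)"
    using x by (intro nn_integral_power_measure_on[OF \<alpha> f]) auto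
  ultimately show "(\<integral>\<^sup>+t\<in>{x<..d}. f t \<partial>power_measure \<alpha>) =
      ennreal \<alpha> * (\<integral>\<^sup>+t\<in>{x..d}. f t * mass t epowr (\<alpha> - 1) * w t \<partial>lebesgue)"
    by simp
qed

text \<open>
  The form of the iterated quantities: \<open>T\<close> is an inner Stieltjes tail, already converted into \<open>\<alpha>\<close> times a
  Lebesgue tail \<open>S\<close>. The outer chain rule contributes \<open>\<beta>\<close>, the power \<open>k/r\<close> contributes \<open>\<alpha> powr (k/r)\<close>, and
  the outer power \<open>1/k\<close> splits these into the two constants. Monotonicity of \<open>S\<close> serves for its
  measurability.
\<close>

lemma nested_integral_power_measure:
  assumes pos: "0 < \<alpha>" "1 < \<beta>" "0 < r" "0 < k"
    and S: "antimono S"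
    and T: "\<And>x. x \<in> {c..d} \<Longrightarrow> T x = ennreal \<alpha> * S x"
  shows "(\<integral>\<^sup>+x\<in>{c..d}. T x epowr (k / r) \<partial>power_measure \<beta>) epowr (1 / k) =
    ennreal (\<alpha> powr (1 / r) * \<beta> powr (1 / k)) *
      (\<integral>\<^sup>+x\<in>{c..d}. S x epowr (k / r) * mass x epowr (\<beta> - 1) * w x \<partial>lebesgue) epowr (1 / k)"
proof -
  define I where "I = (\<integral>\<^sup>+x\<in>{c..d}. S x epowr (k / r) * mass x epowr (\<beta> - 1) * w x \<partial>lebesgue)"
  note [measurable] = borel_measurable_restricted_density
  have S_borel [measurable]: "S \<in> borel_measurable borel"
    using S by (intro borel_measurable_monotone_ennreal) simp
  have [measurable]: "S \<in> borel_measurable lebesgue" "mass \<in> borel_measurable lebesgue"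
    using S_borel borel_measurable_mass by (auto intro: measurable_completion)
  have "(\<integral>\<^sup>+x\<in>{c..d}. T x epowr (k / r) \<partial>power_measure \<beta>) =
      (\<integral>\<^sup>+x\<in>{c..d}. ennreal (\<alpha> powr (k / r)) * S x epowr (k / r) \<partial>power_measure \<beta>)"
    using pos by (intro nn_integral_cong) (auto simp: T ennreal_mult_epowr split: split_indicator)
  also have "\<dots> = ennreal \<beta> * (\<integral>\<^sup>+x\<in>{c..d}. ennreal (\<alpha> powr (k / r)) * S x epowr (k / r) *
      mass x epowr (\<beta> - 1) * w x \<partial>lebesgue)"
    by (rule nn_integral_power_measure_on) (use pos in auto)
  also have "(\<integral>\<^sup>+x\<in>{c..d}. ennreal (\<alpha> powr (k / r)) * S x epowr (k / r) *
      mass x epowr (\<beta> - 1) * w x \<partial>lebesgue) =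
      (\<integral>\<^sup>+x. ennreal (\<alpha> powr (k / r)) * (S x epowr (k / r) *
      mass x epowr (\<beta> - 1) * (w x * indicator {c..d} x)) \<partial>lebesgue)"
    by (simp add: mult_ac)
  also have "\<dots> = ennreal (\<alpha> powr (k / r)) * (\<integral>\<^sup>+x. S x epowr (k / r) *
      mass x epowr (\<beta> - 1) * (w x * indicator {c..d} x) \<partial>lebesgue)"
    by (intro nn_integral_cmult) measurable
  also have "(\<integral>\<^sup>+x. S x epowr (k / r) *
      mass x epowr (\<beta> - 1) * (w x * indicator {c..d} x) \<partial>lebesgue) = I"
    by (simp add: I_def mult_ac)
  finally have "(\<integral>\<^sup>+x\<in>{c..d}. T x epowr (k / r) \<partial>power_measure \<beta>) =
      ennreal (\<beta> * \<alpha> powr (k / r)) * I"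
    using pos by (simp add: ennreal_mult mult.assoc)
  moreover have "(\<beta> * \<alpha> powr (k / r)) powr (1 / k) = \<alpha> powr (1 / r) * \<beta> powr (1 / k)"
    using pos by (simp add: powr_mult powr_powr)
  ultimately show ?thesis
    using pos by (simp add: ennreal_mult_epowr I_def)
qed

end

section \<open>Suprema and exponents\<close>

lemma SUP_closed_interval_eq_open:
  fixes F :: "real \<Rightarrow> ennreal"
  assumes "c < d" "F c = 0" "F d = 0"
  shows "(SUP x\<in>{c..d}. F x) = (SUP x\<in>{c<..<d}. F x)"
proof -
  have "{c..d} = {c, d} \<union> {c<..<d}" using assms by auto
  then show ?thesis using assms by (simp add: SUP_union flip: bot_ennreal)
qed

text \<open>
  The form of the supremum quantities: \<open>\<Psi>\<close> is \<open>\<Phi>\<close> for the other weight and vanishes at \<open>c\<close>; \<open>T\<close> and \<open>S\<close> are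
  the Stieltjes and the Lebesgue tail, which vanish at \<open>d\<close>. These zeros let the endpoints be dropped.
\<close>

lemma SUP_tail_power:
  fixes \<Psi> S T :: "real \<Rightarrow> ennreal"
  assumes "c < d" "0 < r" "0 < \<alpha>"
    and T: "\<And>x. x \<in> {c..d} \<Longrightarrow> T x = ennreal \<alpha> * S x"
    and ends: "\<Psi> c = 0" "S d = 0"
  shows "(SUP x\<in>{c..d}. \<Psi> x * T x epowr (1 / r)) =
    ennreal (\<alpha> powr (1 / r)) * (SUP x\<in>{c<..<d}. \<Psi> x * S x epowr (1 / r))"
proof -
  have "(SUP x\<in>{c..d}. \<Psi> x * T x epowr (1 / r)) =
      (SUP x\<in>{c<..<d}. \<Psi> x * T x epowr (1 / r))"
    using assms by (intro SUP_closed_interval_eq_open) (simp_all add: zero_epowr)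
  also have "\<dots> = (SUP x\<in>{c<..<d}. ennreal (\<alpha> powr (1 / r)) * (\<Psi> x * S x epowr (1 / r)))"
    using assms by (intro SUP_cong) (simp_all add: ennreal_mult_epowr mult_ac)
  finally show ?thesis by (simp add: SUP_mult_left_ennreal)
qed

lemma bounded_density_conjugate_weight:
  assumes "1 < p" "c < d" and v: "v \<in> borel_measurable (lebesgue_on {c..d})"
    and "\<exists>b>0. AE t in lebesgue_on {c..d}. ennreal b \<le> v t"
  shows "\<exists>B. bounded_density c d (\<lambda>t. v t epowr (1 - conj_exp p)) B"
proof -
  obtain b where b: "0 < b" "AE t in lebesgue_on {c..d}. ennreal b \<le> v t"
    using assms by blast
  have neg: "1 - conj_exp p < 0" using \<open>1 < p\<close> by (simp add: conj_exp_def field_simps)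
  have "bounded_density c d (\<lambda>t. v t epowr (1 - conj_exp p)) (b powr (1 - conj_exp p))"
  proof
    show "(\<lambda>t. v t epowr (1 - conj_exp p)) \<in> borel_measurable (lebesgue_on {c..d})"
      using v by measurable
    show "AE t in lebesgue_on {c..d}.
        v t epowr (1 - conj_exp p) \<le> ennreal (b powr (1 - conj_exp p))"
      using b(2) by eventually_elim (rule epowr_neg_le[OF b(1) _ neg])
  qed (use assms in auto)
  then show ?thesis ..
qed

text \<open>
  With \<open>1/s' = 1 - 1/s\<close> one has \<open>1/p' - 1/q' = 1/q - 1/p = 1/r\<close>; multiplying by \<open>r\<close> gives the exponent that
  the chain rule leaves on \<open>V\<close>. The lemma is applied a second time with \<open>r\<close> in the place of \<open>q\<close>, and then
  it produces \<open>\<kappa>\<close>.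
\<close>

lemma scaled_conjugate_exponent:
  assumes "1 < q" "q < p"
  defines "r \<equiv> 1 / (1 / q - 1 / p)"
  shows "0 < r" "r / conj_exp p - 1 = r / conj_exp q" "1 < r / conj_exp p" "1 / r = 1 / q - 1 / p"
proof -
  have lt: "1 / p < 1 / q" using assms by (simp add: frac_less2)
  then show r: "0 < r" by (simp add: r_def)
  show inv: "1 / r = 1 / q - 1 / p" by (simp add: r_def)
  have conj: "1 / conj_exp s = 1 - 1 / s" if "1 < s" for s
    using that by (simp add: conj_exp_def field_simps)
  have "r / conj_exp p - r / conj_exp q = r * (1 / conj_exp p - 1 / conj_exp q)"
    by (simp add: right_diff_distrib)
  also have "\<dots> = r * (1 / r)"
    using assms by (simp add: conj inv)
  also have "\<dots> = 1" using r by simp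
  finally show eq: "r / conj_exp p - 1 = r / conj_exp q" by simp
  have "0 < conj_exp q" using assms by (simp add: conj_exp_def)
  then have "0 < r / conj_exp q" using r by simp
  then show "1 < r / conj_exp p" using eq by simp
qed

text \<open>
  The condition \<open>1/q > 1/p\<^sub>1 + 1/p\<^sub>2\<close> places \<open>r\<^sub>2\<close> below \<open>p\<^sub>1\<close>, and \<open>q > 1\<close> places it above \<open>1\<close>; the second
  application of \<open>scaled_conjugate_exponent\<close> requires both (and likewise with the indices exchanged).
\<close>

lemma exponent_between:
  fixes r a q s :: real
  assumes "1 / r = 1 / q - 1 / a" "0 < r" "1 < q" "0 < a" "1 < s" "1 / s + 1 / a < 1 / q"
  shows "1 < r" "r < s"
proof -
  have "1 / q < 1" "0 < 1 / a" using assms by simp_all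
  then have "1 / r < 1" "1 / s < 1 / r" using assms by linarith+
  then show "1 < r" "r < s"
    using \<open>0 < r\<close> \<open>1 < s\<close> by (simp_all add: field_simps)
qed

section \<open>The Stieltjes and the classical quantities\<close>

theorem proposition8p2:
  fixes c d p\<^sub>1 p\<^sub>2 q :: real
    and u v\<^sub>1 v\<^sub>2 :: "real \<Rightarrow> ennreal"
  assumes "1 < p\<^sub>1" and "1 < p\<^sub>2" and "1 < q" and "c < d"
    and "u \<in> borel_measurable (lebesgue_on {c..d})"
    and "v\<^sub>1 \<in> borel_measurable (lebesgue_on {c..d})"
    and "v\<^sub>2 \<in> borel_measurable (lebesgue_on {c..d})"
    and "AE t in lebesgue_on {c..d}. 0 < u t \<and> u t < \<infinity>"
    and "AE t in lebesgue_on {c..d}. 0 < v\<^sub>1 t \<and> v\<^sub>1 t < \<infinity>"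
    and "AE t in lebesgue_on {c..d}. 0 < v\<^sub>2 t \<and> v\<^sub>2 t < \<infinity>"
    and "(\<integral>\<^sup>+t\<in>{c..d}. u t \<partial>lebesgue) < \<infinity>"
    and "\<exists>b>0. AE t in lebesgue_on {c..d}. ennreal b \<le> v\<^sub>1 t"
    and "\<exists>b>0. AE t in lebesgue_on {c..d}. ennreal b \<le> v\<^sub>2 t"
  shows
    "(p\<^sub>1 \<le> q \<and> p\<^sub>2 \<le> q \<or> p\<^sub>1 \<le> q \<and> q < p\<^sub>2 \<or> p\<^sub>2 \<le> q \<and> q < p\<^sub>1 \<longrightarrow>
        \<BB>\<^sub>1 c d p\<^sub>1 p\<^sub>2 q u v\<^sub>1 v\<^sub>2 = A\<^sub>1 c d p\<^sub>1 p\<^sub>2 q u v\<^sub>1 v\<^sub>2) \<and>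
     (p\<^sub>1 \<le> q \<and> q < p\<^sub>2 \<longrightarrow>
        \<BB>\<^sub>2 c d p\<^sub>1 p\<^sub>2 q u v\<^sub>1 v\<^sub>2 =
          ennreal ((r\<^sub>2 p\<^sub>2 q / conj_exp p\<^sub>2) powr (1 / r\<^sub>2 p\<^sub>2 q)) * A\<^sub>2 c d p\<^sub>1 p\<^sub>2 q u v\<^sub>1 v\<^sub>2) \<and>
     (p\<^sub>2 \<le> q \<and> q < p\<^sub>1 \<longrightarrow>
        \<BB>\<^sub>3 c d p\<^sub>1 p\<^sub>2 q u v\<^sub>1 v\<^sub>2 =
          ennreal ((r\<^sub>1 p\<^sub>1 q / conj_exp p\<^sub>1) powr (1 / r\<^sub>1 p\<^sub>1 q)) * A\<^sub>3 c d p\<^sub>1 p\<^sub>2 q u v\<^sub>1 v\<^sub>2) \<and>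
     (q < min p\<^sub>1 p\<^sub>2 \<and> 1 / q \<le> 1 / p\<^sub>1 + 1 / p\<^sub>2 \<longrightarrow>
        \<BB>\<^sub>4 c d p\<^sub>1 p\<^sub>2 q u v\<^sub>1 v\<^sub>2 =
          ennreal ((r\<^sub>2 p\<^sub>2 q / conj_exp p\<^sub>2) powr (1 / r\<^sub>2 p\<^sub>2 q)) * A\<^sub>4 c d p\<^sub>1 p\<^sub>2 q u v\<^sub>1 v\<^sub>2 \<and>
        \<BB>\<^sub>5 c d p\<^sub>1 p\<^sub>2 q u v\<^sub>1 v\<^sub>2 =
          ennreal ((r\<^sub>1 p\<^sub>1 q / conj_exp p\<^sub>1) powr (1 / r\<^sub>1 p\<^sub>1 q)) * A\<^sub>5 c d p\<^sub>1 p\<^sub>2 q u v\<^sub>1 v\<^sub>2) \<and>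
     (q < min p\<^sub>1 p\<^sub>2 \<and> 1 / q > 1 / p\<^sub>1 + 1 / p\<^sub>2 \<longrightarrow>
        \<BB>\<^sub>6 c d p\<^sub>1 p\<^sub>2 q u v\<^sub>1 v\<^sub>2 =
          ennreal ((r\<^sub>2 p\<^sub>2 q / conj_exp p\<^sub>2) powr (1 / r\<^sub>2 p\<^sub>2 q) *
                   (\<kappa> p\<^sub>1 p\<^sub>2 q / conj_exp p\<^sub>1) powr (1 / \<kappa> p\<^sub>1 p\<^sub>2 q)) *
          A\<^sub>6 c d p\<^sub>1 p\<^sub>2 q u v\<^sub>1 v\<^sub>2 \<and>
        \<BB>\<^sub>7 c d p\<^sub>1 p\<^sub>2 q u v\<^sub>1 v\<^sub>2 =
          ennreal ((r\<^sub>1 p\<^sub>1 q / conj_exp p\<^sub>1) powr (1 / r\<^sub>1 p\<^sub>1 q) *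
                   (\<kappa> p\<^sub>1 p\<^sub>2 q / conj_exp p\<^sub>2) powr (1 / \<kappa> p\<^sub>1 p\<^sub>2 q)) *
          A\<^sub>7 c d p\<^sub>1 p\<^sub>2 q u v\<^sub>1 v\<^sub>2)"
proof -
  define w\<^sub>1 where "w\<^sub>1 = (\<lambda>t. v\<^sub>1 t epowr (1 - conj_exp p\<^sub>1))"
  define w\<^sub>2 where "w\<^sub>2 = (\<lambda>t. v\<^sub>2 t epowr (1 - conj_exp p\<^sub>2))"
  obtain B\<^sub>1 where "bounded_density c d w\<^sub>1 B\<^sub>1"
    unfolding w\<^sub>1_def using bounded_density_conjugate_weight assms by blast
  then interpret D1: bounded_density c d w\<^sub>1 B\<^sub>1 .
  obtain B\<^sub>2 where "bounded_density c d w\<^sub>2 B\<^sub>2"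
    unfolding w\<^sub>2_def using bounded_density_conjugate_weight assms by blast
  then interpret D2: bounded_density c d w\<^sub>2 B\<^sub>2 .
  have w: "v\<^sub>1 t epowr (1 - conj_exp p\<^sub>1) = w\<^sub>1 t" "v\<^sub>2 t epowr (1 - conj_exp p\<^sub>2) = w\<^sub>2 t" for t
    by (simp_all add: w\<^sub>1_def w\<^sub>2_def)
  have V1: "V\<^sub>1 c p\<^sub>1 v\<^sub>1 = D1.mass"
    by (simp add: fun_eq_iff V\<^sub>1_def D1.mass_def w)
  have V2: "V\<^sub>2 c p\<^sub>2 v\<^sub>2 = D2.mass"
    by (simp add: fun_eq_iff V\<^sub>2_def D2.mass_def w)
  have conj_pos: "0 < conj_exp p\<^sub>1" "0 < conj_exp p\<^sub>2"
    using assms by (simp_all add: conj_exp_def)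
  have Phi1: "\<Phi>\<^sub>1 c p\<^sub>1 v\<^sub>1 = (\<lambda>x. D1.mass x epowr (1 / conj_exp p\<^sub>1))"
    by (simp add: fun_eq_iff \<Phi>\<^sub>1_def V1)
  have Phi2: "\<Phi>\<^sub>2 c p\<^sub>2 v\<^sub>2 = (\<lambda>x. D2.mass x epowr (1 / conj_exp p\<^sub>2))"
    by (simp add: fun_eq_iff \<Phi>\<^sub>2_def V2)
  have Phi_left: "\<Phi>\<^sub>1 c p\<^sub>1 v\<^sub>1 c = 0" "\<Phi>\<^sub>2 c p\<^sub>2 v\<^sub>2 c = 0"
    using conj_pos by (simp_all add: Phi1 Phi2 D1.mass_left D2.mass_left zero_epowr)
  define tail_u where "tail_u = U d u"
  have "antimono tail_u"
    unfolding tail_u_def U_def antimono_def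
    by (auto intro!: nn_integral_mono mult_left_mono split: split_indicator)
  then have tail_u: "tail_u \<in> borel_measurable borel"
    by (intro borel_measurable_monotone_ennreal) simp
  have U_right: "tail_u d = 0" by (simp add: tail_u_def U_def nn_integral_null_set)

  \<comment> \<open>The tail integrals inside the classical quantities, without their outer powers.\<close>
  define S\<^sub>1 where "S\<^sub>1 x = (\<integral>\<^sup>+t\<in>{x..d}. tail_u t epowr (r\<^sub>1 p\<^sub>1 q / q) *
    D1.mass t epowr (r\<^sub>1 p\<^sub>1 q / conj_exp q) * w\<^sub>1 t \<partial>lebesgue)" for x
  define S\<^sub>2 where "S\<^sub>2 x = (\<integral>\<^sup>+t\<in>{x..d}. tail_u t epowr (r\<^sub>2 p\<^sub>2 q / q) *
    D2.mass t epowr (r\<^sub>2 p\<^sub>2 q / conj_exp q) * w\<^sub>2 t \<partial>lebesgue)" for x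
  have S_antimono: "antimono S\<^sub>1" "antimono S\<^sub>2"
    unfolding S\<^sub>1_def S\<^sub>2_def antimono_def
    by (auto intro!: nn_integral_mono mult_left_mono split: split_indicator)
  have S_right: "S\<^sub>1 d = 0" "S\<^sub>2 d = 0"
    by (simp_all add: S\<^sub>1_def S\<^sub>2_def nn_integral_null_set)

  have T1: "(\<integral>\<^sup>+t\<in>{x..d}. tail_u t epowr (r\<^sub>1 p\<^sub>1 q / q) \<partial>\<mu>\<^sub>1 c d p\<^sub>1 q v\<^sub>1) =
        ennreal (r\<^sub>1 p\<^sub>1 q / conj_exp p\<^sub>1) * S\<^sub>1 x"
      "(\<integral>\<^sup>+t\<in>{x<..d}. tail_u t epowr (r\<^sub>1 p\<^sub>1 q / q) \<partial>\<mu>\<^sub>1 c d p\<^sub>1 q v\<^sub>1) =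
        ennreal (r\<^sub>1 p\<^sub>1 q / conj_exp p\<^sub>1) * S\<^sub>1 x"
    if "q < p\<^sub>1" "x \<in> {c..d}" for x
  proof -
    note r = scaled_conjugate_exponent[OF \<open>1 < q\<close> \<open>q < p\<^sub>1\<close>, folded r\<^sub>1_def]
    have mu: "\<mu>\<^sub>1 c d p\<^sub>1 q v\<^sub>1 = D1.power_measure (r\<^sub>1 p\<^sub>1 q / conj_exp p\<^sub>1)"
      using r(1) conj_pos by (simp add: \<mu>\<^sub>1_def Phi1 epowr_epowr)
    have f: "(\<lambda>t. tail_u t epowr (r\<^sub>1 p\<^sub>1 q / q)) \<in> borel_measurable borel"
      using tail_u by measurable
    show "(\<integral>\<^sup>+t\<in>{x..d}. tail_u t epowr (r\<^sub>1 p\<^sub>1 q / q) \<partial>\<mu>\<^sub>1 c d p\<^sub>1 q v\<^sub>1) =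
        ennreal (r\<^sub>1 p\<^sub>1 q / conj_exp p\<^sub>1) * S\<^sub>1 x"
      "(\<integral>\<^sup>+t\<in>{x<..d}. tail_u t epowr (r\<^sub>1 p\<^sub>1 q / q) \<partial>\<mu>\<^sub>1 c d p\<^sub>1 q v\<^sub>1) =
        ennreal (r\<^sub>1 p\<^sub>1 q / conj_exp p\<^sub>1) * S\<^sub>1 x"
      using D1.tail_integral_power_measure[OF r(3) f \<open>x \<in> {c..d}\<close>]
      by (simp_all add: mu S\<^sub>1_def r(2))
  qed
  have T2: "(\<integral>\<^sup>+t\<in>{x..d}. tail_u t epowr (r\<^sub>2 p\<^sub>2 q / q) \<partial>\<mu>\<^sub>2 c d p\<^sub>2 q v\<^sub>2) =
        ennreal (r\<^sub>2 p\<^sub>2 q / conj_exp p\<^sub>2) * S\<^sub>2 x"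
      "(\<integral>\<^sup>+t\<in>{x<..d}. tail_u t epowr (r\<^sub>2 p\<^sub>2 q / q) \<partial>\<mu>\<^sub>2 c d p\<^sub>2 q v\<^sub>2) =
        ennreal (r\<^sub>2 p\<^sub>2 q / conj_exp p\<^sub>2) * S\<^sub>2 x"
    if "q < p\<^sub>2" "x \<in> {c..d}" for x
  proof -
    note r = scaled_conjugate_exponent[OF \<open>1 < q\<close> \<open>q < p\<^sub>2\<close>, folded r\<^sub>2_def]
    have mu: "\<mu>\<^sub>2 c d p\<^sub>2 q v\<^sub>2 = D2.power_measure (r\<^sub>2 p\<^sub>2 q / conj_exp p\<^sub>2)"
      using r(1) conj_pos by (simp add: \<mu>\<^sub>2_def Phi2 epowr_epowr)
    have f: "(\<lambda>t. tail_u t epowr (r\<^sub>2 p\<^sub>2 q / q)) \<in> borel_measurable borel"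
      using tail_u by measurable
    show "(\<integral>\<^sup>+t\<in>{x..d}. tail_u t epowr (r\<^sub>2 p\<^sub>2 q / q) \<partial>\<mu>\<^sub>2 c d p\<^sub>2 q v\<^sub>2) =
        ennreal (r\<^sub>2 p\<^sub>2 q / conj_exp p\<^sub>2) * S\<^sub>2 x"
      "(\<integral>\<^sup>+t\<in>{x<..d}. tail_u t epowr (r\<^sub>2 p\<^sub>2 q / q) \<partial>\<mu>\<^sub>2 c d p\<^sub>2 q v\<^sub>2) =
        ennreal (r\<^sub>2 p\<^sub>2 q / conj_exp p\<^sub>2) * S\<^sub>2 x"
      using D2.tail_integral_power_measure[OF r(3) f \<open>x \<in> {c..d}\<close>]
      by (simp_all add: mu S\<^sub>2_def r(2))
  qed

  have B1: "\<BB>\<^sub>1 c d p\<^sub>1 p\<^sub>2 q u v\<^sub>1 v\<^sub>2 = A\<^sub>1 c d p\<^sub>1 p\<^sub>2 q u v\<^sub>1 v\<^sub>2"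
  proof -
    have "tail_u d epowr (1 / q) = 0" using \<open>1 < q\<close> by (simp add: U_right zero_epowr)
    then have "\<BB>\<^sub>1 c d p\<^sub>1 p\<^sub>2 q u v\<^sub>1 v\<^sub>2 =
        (SUP x\<in>{c<..<d}. tail_u x epowr (1 / q) * \<Phi>\<^sub>1 c p\<^sub>1 v\<^sub>1 x * \<Phi>\<^sub>2 c p\<^sub>2 v\<^sub>2 x)"
      unfolding \<BB>\<^sub>1_def tail_u_def[symmetric]
      by (intro SUP_closed_interval_eq_open \<open>c < d\<close>) (simp_all add: Phi_left)
    then show ?thesis by (simp add: A\<^sub>1_def tail_u_def Phi1 Phi2 V1 V2)
  qed

  have sup2: "\<BB>\<^sub>2 c d p\<^sub>1 p\<^sub>2 q u v\<^sub>1 v\<^sub>2 = K * A\<^sub>2 c d p\<^sub>1 p\<^sub>2 q u v\<^sub>1 v\<^sub>2"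
      "\<BB>\<^sub>4 c d p\<^sub>1 p\<^sub>2 q u v\<^sub>1 v\<^sub>2 = K * A\<^sub>4 c d p\<^sub>1 p\<^sub>2 q u v\<^sub>1 v\<^sub>2"
    if "q < p\<^sub>2" and K: "K = ennreal ((r\<^sub>2 p\<^sub>2 q / conj_exp p\<^sub>2) powr (1 / r\<^sub>2 p\<^sub>2 q))" for K
  proof -
    note r = scaled_conjugate_exponent[OF \<open>1 < q\<close> \<open>q < p\<^sub>2\<close>, folded r\<^sub>2_def]
    have \<alpha>: "0 < r\<^sub>2 p\<^sub>2 q / conj_exp p\<^sub>2" using r(3) by linarith
    have A: "A\<^sub>2 c d p\<^sub>1 p\<^sub>2 q u v\<^sub>1 v\<^sub>2 =
        (SUP x\<in>{c<..<d}. \<Phi>\<^sub>1 c p\<^sub>1 v\<^sub>1 x * S\<^sub>2 x epowr (1 / r\<^sub>2 p\<^sub>2 q))"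
      by (simp add: A\<^sub>2_def Phi1 V1 V2 S\<^sub>2_def tail_u_def w)
    show "\<BB>\<^sub>2 c d p\<^sub>1 p\<^sub>2 q u v\<^sub>1 v\<^sub>2 = K * A\<^sub>2 c d p\<^sub>1 p\<^sub>2 q u v\<^sub>1 v\<^sub>2"
      unfolding \<BB>\<^sub>2_def A K tail_u_def[symmetric]
      by (rule SUP_tail_power) (fact \<open>c < d\<close> r(1) \<alpha> T2(2)[OF \<open>q < p\<^sub>2\<close>] Phi_left(1) S_right(2))+
    show "\<BB>\<^sub>4 c d p\<^sub>1 p\<^sub>2 q u v\<^sub>1 v\<^sub>2 = K * A\<^sub>4 c d p\<^sub>1 p\<^sub>2 q u v\<^sub>1 v\<^sub>2"
      unfolding \<BB>\<^sub>4_def A\<^sub>4_def A K tail_u_def[symmetric]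
      by (rule SUP_tail_power) (fact \<open>c < d\<close> r(1) \<alpha> T2(1)[OF \<open>q < p\<^sub>2\<close>] Phi_left(1) S_right(2))+
  qed
  have sup1: "\<BB>\<^sub>3 c d p\<^sub>1 p\<^sub>2 q u v\<^sub>1 v\<^sub>2 = K * A\<^sub>3 c d p\<^sub>1 p\<^sub>2 q u v\<^sub>1 v\<^sub>2"
      "\<BB>\<^sub>5 c d p\<^sub>1 p\<^sub>2 q u v\<^sub>1 v\<^sub>2 = K * A\<^sub>5 c d p\<^sub>1 p\<^sub>2 q u v\<^sub>1 v\<^sub>2"
    if "q < p\<^sub>1" and K: "K = ennreal ((r\<^sub>1 p\<^sub>1 q / conj_exp p\<^sub>1) powr (1 / r\<^sub>1 p\<^sub>1 q))" for K
  proof -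
    note r = scaled_conjugate_exponent[OF \<open>1 < q\<close> \<open>q < p\<^sub>1\<close>, folded r\<^sub>1_def]
    have \<alpha>: "0 < r\<^sub>1 p\<^sub>1 q / conj_exp p\<^sub>1" using r(3) by linarith
    have A: "A\<^sub>3 c d p\<^sub>1 p\<^sub>2 q u v\<^sub>1 v\<^sub>2 =
        (SUP x\<in>{c<..<d}. \<Phi>\<^sub>2 c p\<^sub>2 v\<^sub>2 x * S\<^sub>1 x epowr (1 / r\<^sub>1 p\<^sub>1 q))"
      by (simp add: A\<^sub>3_def Phi2 V1 V2 S\<^sub>1_def tail_u_def w)
    have B: "(SUP x\<in>{c..d}. \<Phi>\<^sub>2 c p\<^sub>2 v\<^sub>2 x *
        (\<integral>\<^sup>+t\<in>{x<..d}. tail_u t epowr (r\<^sub>1 p\<^sub>1 q / q) \<partial>\<mu>\<^sub>1 c d p\<^sub>1 q v\<^sub>1) epowr (1 / r\<^sub>1 p\<^sub>1 q)) =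
        K * A\<^sub>3 c d p\<^sub>1 p\<^sub>2 q u v\<^sub>1 v\<^sub>2"
      unfolding A K
      by (rule SUP_tail_power) (fact \<open>c < d\<close> r(1) \<alpha> T1(2)[OF \<open>q < p\<^sub>1\<close>] Phi_left(2) S_right(1))+
    show "\<BB>\<^sub>3 c d p\<^sub>1 p\<^sub>2 q u v\<^sub>1 v\<^sub>2 = K * A\<^sub>3 c d p\<^sub>1 p\<^sub>2 q u v\<^sub>1 v\<^sub>2"
      "\<BB>\<^sub>5 c d p\<^sub>1 p\<^sub>2 q u v\<^sub>1 v\<^sub>2 = K * A\<^sub>5 c d p\<^sub>1 p\<^sub>2 q u v\<^sub>1 v\<^sub>2"
      using B by (simp_all add: \<BB>\<^sub>3_def \<BB>\<^sub>5_def A\<^sub>5_def tail_u_def)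
  qed

  have nested: "\<BB>\<^sub>6 c d p\<^sub>1 p\<^sub>2 q u v\<^sub>1 v\<^sub>2 =
        ennreal ((r\<^sub>2 p\<^sub>2 q / conj_exp p\<^sub>2) powr (1 / r\<^sub>2 p\<^sub>2 q) *
          (\<kappa> p\<^sub>1 p\<^sub>2 q / conj_exp p\<^sub>1) powr (1 / \<kappa> p\<^sub>1 p\<^sub>2 q)) *
        A\<^sub>6 c d p\<^sub>1 p\<^sub>2 q u v\<^sub>1 v\<^sub>2"
      "\<BB>\<^sub>7 c d p\<^sub>1 p\<^sub>2 q u v\<^sub>1 v\<^sub>2 =
        ennreal ((r\<^sub>1 p\<^sub>1 q / conj_exp p\<^sub>1) powr (1 / r\<^sub>1 p\<^sub>1 q) *
          (\<kappa> p\<^sub>1 p\<^sub>2 q / conj_exp p\<^sub>2) powr (1 / \<kappa> p\<^sub>1 p\<^sub>2 q)) *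
        A\<^sub>7 c d p\<^sub>1 p\<^sub>2 q u v\<^sub>1 v\<^sub>2"
    if lt: "q < p\<^sub>1" "q < p\<^sub>2" and gap: "1 / p\<^sub>1 + 1 / p\<^sub>2 < 1 / q"
  proof -
    note r1 = scaled_conjugate_exponent[OF \<open>1 < q\<close> \<open>q < p\<^sub>1\<close>, folded r\<^sub>1_def]
    note r2 = scaled_conjugate_exponent[OF \<open>1 < q\<close> \<open>q < p\<^sub>2\<close>, folded r\<^sub>2_def]
    have "1 < r\<^sub>2 p\<^sub>2 q" "r\<^sub>2 p\<^sub>2 q < p\<^sub>1"
      by (rule exponent_between[OF r2(4) r2(1), of p\<^sub>1]; use assms gap in simp)+
    \<comment> \<open>Second use of the exponent identity, now for \<open>1/\<kappa> = 1/r\<^sub>2 - 1/p\<^sub>1 = 1/r\<^sub>1 - 1/p\<^sub>2\<close>.\<close>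
    note k1 = scaled_conjugate_exponent[OF this]
    have "1 < r\<^sub>1 p\<^sub>1 q" "r\<^sub>1 p\<^sub>1 q < p\<^sub>2"
      by (rule exponent_between[OF r1(4) r1(1), of p\<^sub>2]; use assms gap in simp)+
    note k2 = scaled_conjugate_exponent[OF this]
    have k_eq: "1 / (1 / r\<^sub>2 p\<^sub>2 q - 1 / p\<^sub>1) = \<kappa> p\<^sub>1 p\<^sub>2 q"
        "1 / (1 / r\<^sub>1 p\<^sub>1 q - 1 / p\<^sub>2) = \<kappa> p\<^sub>1 p\<^sub>2 q"
      unfolding r1(4) r2(4) by (simp_all add: \<kappa>_def algebra_simps)
    note k1 = k1[unfolded k_eq] and k2 = k2[unfolded k_eq]
    have \<alpha>1: "0 < r\<^sub>1 p\<^sub>1 q / conj_exp p\<^sub>1" and \<alpha>2: "0 < r\<^sub>2 p\<^sub>2 q / conj_exp p\<^sub>2"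
      using r1(3) r2(3) by linarith+
    have pm1: "stieltjes_measure c d (\<lambda>x. enn2real (\<Phi>\<^sub>1 c p\<^sub>1 v\<^sub>1 x epowr \<kappa> p\<^sub>1 p\<^sub>2 q)) =
        D1.power_measure (\<kappa> p\<^sub>1 p\<^sub>2 q / conj_exp p\<^sub>1)"
      using k1(1) conj_pos by (simp add: Phi1 epowr_epowr)
    have pm2: "stieltjes_measure c d (\<lambda>x. enn2real (\<Phi>\<^sub>2 c p\<^sub>2 v\<^sub>2 x epowr \<kappa> p\<^sub>1 p\<^sub>2 q)) =
        D2.power_measure (\<kappa> p\<^sub>1 p\<^sub>2 q / conj_exp p\<^sub>2)"
      using k1(1) conj_pos by (simp add: Phi2 epowr_epowr)
    show "\<BB>\<^sub>6 c d p\<^sub>1 p\<^sub>2 q u v\<^sub>1 v\<^sub>2 =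
        ennreal ((r\<^sub>2 p\<^sub>2 q / conj_exp p\<^sub>2) powr (1 / r\<^sub>2 p\<^sub>2 q) *
          (\<kappa> p\<^sub>1 p\<^sub>2 q / conj_exp p\<^sub>1) powr (1 / \<kappa> p\<^sub>1 p\<^sub>2 q)) *
        A\<^sub>6 c d p\<^sub>1 p\<^sub>2 q u v\<^sub>1 v\<^sub>2"
      using D1.nested_integral_power_measure[where T = "\<lambda>x. \<integral>\<^sup>+t\<in>{x..d}. tail_u t epowr (r\<^sub>2 p\<^sub>2 q / q) \<partial>\<mu>\<^sub>2 c d p\<^sub>2 q v\<^sub>2",
        OF \<alpha>2 k1(3) r2(1) k1(1) S_antimono(2) T2(1)[OF lt(2)]]
      by (simp add: \<BB>\<^sub>6_def A\<^sub>6_def pm1 k1(2) tail_u_def S\<^sub>2_def V1 V2 w)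
    show "\<BB>\<^sub>7 c d p\<^sub>1 p\<^sub>2 q u v\<^sub>1 v\<^sub>2 =
        ennreal ((r\<^sub>1 p\<^sub>1 q / conj_exp p\<^sub>1) powr (1 / r\<^sub>1 p\<^sub>1 q) *
          (\<kappa> p\<^sub>1 p\<^sub>2 q / conj_exp p\<^sub>2) powr (1 / \<kappa> p\<^sub>1 p\<^sub>2 q)) *
        A\<^sub>7 c d p\<^sub>1 p\<^sub>2 q u v\<^sub>1 v\<^sub>2"
      using D2.nested_integral_power_measure[where T = "\<lambda>x. \<integral>\<^sup>+t\<in>{x<..d}. tail_u t epowr (r\<^sub>1 p\<^sub>1 q / q) \<partial>\<mu>\<^sub>1 c d p\<^sub>1 q v\<^sub>1",
        OF \<alpha>1 k2(3) r1(1) k2(1) S_antimono(1) T1(2)[OF lt(1)]]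
      by (simp add: \<BB>\<^sub>7_def A\<^sub>7_def pm2 k2(2) tail_u_def S\<^sub>1_def V1 V2 w)
  qed
  show ?thesis
    using B1 sup1 sup2 nested by auto
qed

end
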